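(* Let $D$ be a set and let $Z=(Z_{\mathbf{x}})_{\mathbf{x}\in D}$ be a real-valued, square-integrable, centred random field indexed by $D$, with covariance kernel $k$. Let $q\in\mathbb{N}\setminus\{0\}$, let $v_1,\dots,v_q: D\to D$ be arbitrary functions, let $\alpha_1,\dots,\alpha_q\in\mathbb{R}$, and let $T=\sum_{i=1}^q \alpha_i T_{v_i}$ be the combination of composition operators with symbols $v_i$ and weights $\alpha_i$. Then $Z$ equals $T(Z)$ up to a modification, i.e. $$\forall \mathbf{x}\in D,\quad \mathbb{P}\left(Z_{\mathbf{x}}=T(Z)_{\mathbf{x}}\right)=1,$$ if and only if $k$ is $T$-invariant, i.e. $$\forall \mathbf{x}'\in D,\quad T(k(\cdot,\mathbf{x}'))=k(\cdot,\mathbf{x}').$$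
   Context: For a function $v:D\to D$, the composition operator with symbol $v$ is $T_v:\mathbb{R}^D\to\mathbb{R}^D$, $T_v(f)=f\circ v$. It acts on random fields indexed by $D$ by $T_v(Z)_{\mathbf{x}}=Z_{v(\mathbf{x})}$. Thus for $T=\sum_{i=1}^q\alpha_iT_{v_i}$ one has $T(f)(\mathbf{x})=\sum_{i=1}^q\alpha_i f(v_i(\mathbf{x}))$ for $f\in\mathbb{R}^D$ and $T(Z)_{\mathbf{x}}=\sum_{i=1}^q\alpha_i Z_{v_i(\mathbf{x})}$. "Centred" means $\mathbb{E}[Z_{\mathbf{x}}]=0$ for all $\mathbf{x}$; "square-integrable" means $\mathbb{E}[Z_{\mathbf{x}}^2]<\infty$ for all $\mathbf{x}$; the covariance kernel is $k(\mathbf{x},\mathbf{x}')=\operatorname{cov}(Z_{\mathbf{x}},Z_{\mathbf{x}'})$. *)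

theory Defs
  imports "HOL-Probability.Probability"
begin

definition covariance :: "'w measure \<Rightarrow> ('w \<Rightarrow> real) \<Rightarrow> ('w \<Rightarrow> real) \<Rightarrow> real" where
  "covariance M X Y =
     integral\<^sup>L M (\<lambda>\<omega>. (X \<omega> - integral\<^sup>L M X) * (Y \<omega> - integral\<^sup>L M Y))"

definition covariance_kernel :: "'w measure \<Rightarrow> ('d \<Rightarrow> 'w \<Rightarrow> real) \<Rightarrow> 'd \<Rightarrow> 'd \<Rightarrow> real" where
  "covariance_kernel M Z x x' = covariance M (Z x) (Z x')"

text \<open>
  A function or field indexed by a set \<open>D\<close> is represented by a total function on the type \<open>'d\<close>
  of which only the values on \<open>D\<close> matter; symbols \<open>v\<close> are assumed to map \<open>D\<close> into \<open>D\<close>. The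
  codomain \<open>'b\<close> is \<open>real\<close> for elements of \<open>\<real>\<^sup>D\<close>, and \<open>'w \<Rightarrow> real\<close> for random fields.
\<close>

definition composition_operator :: "('d \<Rightarrow> 'd) \<Rightarrow> ('d \<Rightarrow> 'b) \<Rightarrow> 'd \<Rightarrow> 'b" where
  "composition_operator v f = f \<circ> v"

definition composition_combination ::
    "nat \<Rightarrow> (nat \<Rightarrow> real) \<Rightarrow> (nat \<Rightarrow> 'd \<Rightarrow> 'd) \<Rightarrow> ('d \<Rightarrow> real) \<Rightarrow> 'd \<Rightarrow> real" where
  "composition_combination q \<alpha> v f x = (\<Sum>i=1..q. \<alpha> i * composition_operator (v i) f x)"

definition composition_combination_field ::
    "nat \<Rightarrow> (nat \<Rightarrow> real) \<Rightarrow> (nat \<Rightarrow> 'd \<Rightarrow> 'd) \<Rightarrow> ('d \<Rightarrow> 'w \<Rightarrow> real) \<Rightarrow> 'd \<Rightarrow> 'w \<Rightarrow> real" where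
  "composition_combination_field q \<alpha> v Z x \<omega> =
     (\<Sum>i=1..q. \<alpha> i * composition_operator (v i) Z x \<omega>)"

end

theory Submission
  imports Defs
begin

text \<open>
  For a centred field the covariance is the \<open>L\<^sup>2\<close> inner product. Fix \<open>x\<close> and let
  \<open>R = T(Z)\<^sub>x - Z\<^sub>x\<close> be the residual. By linearity of the expectation
  \<open>E[R Z\<^sub>x\<^sub>']\<close> is \<open>T(k(\<cdot>,x'))(x) - k(x,x')\<close>, so invariance of the kernel says exactly
  that every residual is orthogonal to the whole field (\<open>expectation_residual_times_field\<close>).
  A residual that vanishes almost surely is certainly orthogonal to everything. Conversely, \<open>R\<close> is
  itself a linear combination of field variables, because the symbols map \<open>D\<close> into \<open>D\<close>; hence
  orthogonality to the field forces \<open>E[R\<^sup>2] = 0\<close>, that is, \<open>R = 0\<close> almost surely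
  (\<open>AE_eq_combination_if_orthogonal\<close>).
\<close>

text \<open>The product is dominated by the sum of the two squares.\<close>

lemma integrable_mult_of_square_integrable:
  fixes X Y :: "'w \<Rightarrow> real"
  assumes [measurable]: "X \<in> borel_measurable M" "Y \<in> borel_measurable M"
    and "integrable M (\<lambda>\<omega>. (X \<omega>)\<^sup>2)" "integrable M (\<lambda>\<omega>. (Y \<omega>)\<^sup>2)"
  shows "integrable M (\<lambda>\<omega>. X \<omega> * Y \<omega>)"
proof (rule Bochner_Integration.integrable_bound)
  show "integrable M (\<lambda>\<omega>. (X \<omega>)\<^sup>2 + (Y \<omega>)\<^sup>2)"
    using assms by simp
  have "\<bar>a * b\<bar> \<le> a\<^sup>2 + b\<^sup>2" for a b :: real
  proof -
    have "2 * (\<bar>a\<bar> * \<bar>b\<bar>) \<le> a\<^sup>2 + b\<^sup>2"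
      using zero_le_power2[of "\<bar>a\<bar> - \<bar>b\<bar>"] by (simp add: power2_diff)
    moreover have "0 \<le> \<bar>a\<bar> * \<bar>b\<bar>"
      by simp
    ultimately show ?thesis
      by (simp only: abs_mult)
  qed
  then show "AE \<omega> in M. norm (X \<omega> * Y \<omega>) \<le> norm ((X \<omega>)\<^sup>2 + (Y \<omega>)\<^sup>2)"
    by simp
qed measurable

lemma expectation_residual_times_field:
  fixes X W :: "'w \<Rightarrow> real" and Y :: "'i \<Rightarrow> 'w \<Rightarrow> real"
  assumes "integrable M (\<lambda>\<omega>. X \<omega> * W \<omega>)"
    and "\<And>i. i \<in> I \<Longrightarrow> integrable M (\<lambda>\<omega>. Y i \<omega> * W \<omega>)"
  shows "integrable M (\<lambda>\<omega>. ((\<Sum>i\<in>I. a i * Y i \<omega>) - X \<omega>) * W \<omega>)"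
    and "(\<integral>\<omega>. ((\<Sum>i\<in>I. a i * Y i \<omega>) - X \<omega>) * W \<omega> \<partial>M)
      = (\<Sum>i\<in>I. a i * (\<integral>\<omega>. Y i \<omega> * W \<omega> \<partial>M)) - (\<integral>\<omega>. X \<omega> * W \<omega> \<partial>M)"
proof -
  have expand: "(\<lambda>\<omega>. ((\<Sum>i\<in>I. a i * Y i \<omega>) - X \<omega>) * W \<omega>)
      = (\<lambda>\<omega>. (\<Sum>i\<in>I. a i * (Y i \<omega> * W \<omega>)) - X \<omega> * W \<omega>)"
    by (simp add: left_diff_distrib sum_distrib_right mult.assoc)
  have sum: "integrable M (\<lambda>\<omega>. \<Sum>i\<in>I. a i * (Y i \<omega> * W \<omega>))"
    using assms(2) by (intro Bochner_Integration.integrable_sum integrable_mult_right)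
  then show "integrable M (\<lambda>\<omega>. ((\<Sum>i\<in>I. a i * Y i \<omega>) - X \<omega>) * W \<omega>)"
    unfolding expand using assms(1) by (rule Bochner_Integration.integrable_diff)
  have "(\<integral>\<omega>. (\<Sum>i\<in>I. a i * (Y i \<omega> * W \<omega>)) \<partial>M)
      = (\<Sum>i\<in>I. a i * (\<integral>\<omega>. Y i \<omega> * W \<omega> \<partial>M))"
    using assms(2) by (subst Bochner_Integration.integral_sum) auto
  then show "(\<integral>\<omega>. ((\<Sum>i\<in>I. a i * Y i \<omega>) - X \<omega>) * W \<omega> \<partial>M)
      = (\<Sum>i\<in>I. a i * (\<integral>\<omega>. Y i \<omega> * W \<omega> \<partial>M)) - (\<integral>\<omega>. X \<omega> * W \<omega> \<partial>M)"
    unfolding expand using sum assms(1) by simp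
qed

text \<open>
  A vector of the span of \<open>X\<close> and the \<open>Y i\<close> that is orthogonal to these generators is orthogonal to
  itself, so its \<open>L\<^sup>2\<close> norm vanishes.
\<close>

lemma AE_eq_combination_if_orthogonal:
  fixes X :: "'w \<Rightarrow> real" and Y :: "'i \<Rightarrow> 'w \<Rightarrow> real" and a :: "'i \<Rightarrow> real"
    and I :: "'i set"
  defines "R \<equiv> \<lambda>\<omega>. (\<Sum>i\<in>I. a i * Y i \<omega>) - X \<omega>"
  assumes X: "integrable M (\<lambda>\<omega>. X \<omega> * R \<omega>)" "(\<integral>\<omega>. R \<omega> * X \<omega> \<partial>M) = 0"
    and Y: "\<And>i. i \<in> I \<Longrightarrow> integrable M (\<lambda>\<omega>. Y i \<omega> * R \<omega>)"
      "\<And>i. i \<in> I \<Longrightarrow> (\<integral>\<omega>. R \<omega> * Y i \<omega> \<partial>M) = 0"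
  shows "AE \<omega> in M. X \<omega> = (\<Sum>i\<in>I. a i * Y i \<omega>)"
proof -
  have int: "integrable M (\<lambda>\<omega>. R \<omega> * R \<omega>)"
    using expectation_residual_times_field(1)[OF X(1) Y(1), where a = a] by (simp add: R_def)
  have "(\<integral>\<omega>. R \<omega> * R \<omega> \<partial>M)
      = (\<Sum>i\<in>I. a i * (\<integral>\<omega>. Y i \<omega> * R \<omega> \<partial>M)) - (\<integral>\<omega>. X \<omega> * R \<omega> \<partial>M)"
    using expectation_residual_times_field(2)[OF X(1) Y(1), where a = a] by (simp add: R_def)
  also have "\<dots> = 0"
    using X(2) Y(2) by (simp add: mult.commute)
  finally have "AE \<omega> in M. R \<omega> * R \<omega> = 0"
    using integral_nonneg_eq_0_iff_AE[OF int] by simp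
  then show ?thesis
    by eventually_elim (simp add: R_def)
qed

theorem proposition3:
  fixes M :: "'w measure" and D :: "'d set" and Z :: "'d \<Rightarrow> 'w \<Rightarrow> real"
    and k :: "'d \<Rightarrow> 'd \<Rightarrow> real"
    and q :: nat and v :: "nat \<Rightarrow> 'd \<Rightarrow> 'd" and \<alpha> :: "nat \<Rightarrow> real"
  assumes "prob_space M"
    and random_field: "\<And>x. x \<in> D \<Longrightarrow> Z x \<in> borel_measurable M"
    and square_integrable: "\<And>x. x \<in> D \<Longrightarrow> integrable M (\<lambda>\<omega>. (Z x \<omega>)\<^sup>2)"
    and centred: "\<And>x. x \<in> D \<Longrightarrow> integral\<^sup>L M (Z x) = 0"
    and kernel: "\<And>x x'. x \<in> D \<Longrightarrow> x' \<in> D \<Longrightarrow> k x x' = covariance_kernel M Z x x'"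
    and "q \<noteq> 0"
    and symbols: "\<And>i. i \<in> {1..q} \<Longrightarrow> v i \<in> D \<rightarrow> D"
  shows "(\<forall>x\<in>D. \<P>(\<omega> in M. Z x \<omega> = composition_combination_field q \<alpha> v Z x \<omega>) = 1)
    \<longleftrightarrow> (\<forall>x'\<in>D. \<forall>x\<in>D. composition_combination q \<alpha> v (\<lambda>y. k y x') x = k x x')"
proof -
  interpret prob_space M by fact
  define TZ where "TZ x \<omega> = (\<Sum>i=1..q. \<alpha> i * Z (v i x) \<omega>)" for x \<omega>
  have TZ: "composition_combination_field q \<alpha> v Z = TZ"
    by (intro ext) (simp add: composition_combination_field_def composition_operator_def TZ_def)
  have vD: "v i x \<in> D" if "i \<in> {1..q}" "x \<in> D" for i x
    using symbols that by auto
  have TZ_measurable: "TZ x \<in> borel_measurable M" if "x \<in> D" for x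
    unfolding TZ_def using that
    by (intro borel_measurable_sum borel_measurable_times borel_measurable_const random_field vD)
  have int: "integrable M (\<lambda>\<omega>. Z x \<omega> * Z y \<omega>)" if "x \<in> D" "y \<in> D" for x y
    using that by (intro integrable_mult_of_square_integrable random_field square_integrable)
  have k: "k x y = (\<integral>\<omega>. Z x \<omega> * Z y \<omega> \<partial>M)" if "x \<in> D" "y \<in> D" for x y
    using that by (simp add: kernel covariance_kernel_def covariance_def centred)
  have modification: "\<P>(\<omega> in M. Z x \<omega> = TZ x \<omega>) = 1 \<longleftrightarrow> (AE \<omega> in M. Z x \<omega> = TZ x \<omega>)"
    if "x \<in> D" for x
  proof (rule prob_Collect_eq_1)
    note [measurable] = random_field[OF that] TZ_measurable[OF that]
    show "{\<omega> \<in> space M. Z x \<omega> = TZ x \<omega>} \<in> events"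
      by measurable
  qed
  have residual_integrable: "integrable M (\<lambda>\<omega>. (TZ x \<omega> - Z x \<omega>) * Z y \<omega>)"
    if "x \<in> D" "y \<in> D" for x y
    unfolding TZ_def using that by (intro expectation_residual_times_field(1) int vD)
  have residual: "(\<integral>\<omega>. (TZ x \<omega> - Z x \<omega>) * Z y \<omega> \<partial>M)
      = composition_combination q \<alpha> v (\<lambda>z. k z y) x - k x y" if "x \<in> D" "y \<in> D" for x y
  proof -
    have "(\<integral>\<omega>. (TZ x \<omega> - Z x \<omega>) * Z y \<omega> \<partial>M)
        = (\<Sum>i=1..q. \<alpha> i * (\<integral>\<omega>. Z (v i x) \<omega> * Z y \<omega> \<partial>M)) - (\<integral>\<omega>. Z x \<omega> * Z y \<omega> \<partial>M)"
      unfolding TZ_def using that by (intro expectation_residual_times_field(2) int vD)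
    then show ?thesis
      using that by (simp add: composition_combination_def composition_operator_def k vD)
  qed
  show ?thesis
    unfolding TZ
  proof (intro iffI ballI)
    fix x' x
    assume "\<forall>x\<in>D. \<P>(\<omega> in M. Z x \<omega> = TZ x \<omega>) = 1" and D: "x' \<in> D" "x \<in> D"
    then have "AE \<omega> in M. Z x \<omega> = TZ x \<omega>"
      using modification by blast
    then have "AE \<omega> in M. (TZ x \<omega> - Z x \<omega>) * Z x' \<omega> = 0"
      by eventually_elim simp
    then have "(\<integral>\<omega>. (TZ x \<omega> - Z x \<omega>) * Z x' \<omega> \<partial>M) = 0"
      by (rule integral_eq_zero_AE)
    then show "composition_combination q \<alpha> v (\<lambda>y. k y x') x = k x x'"
      using residual[OF D(2,1)] by simp
  next
    fix x
    assume invariant: "\<forall>x'\<in>D. \<forall>x\<in>D. composition_combination q \<alpha> v (\<lambda>y. k y x') x = k x x'"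
      and x: "x \<in> D"
    have orthogonal: "(\<integral>\<omega>. (TZ x \<omega> - Z x \<omega>) * Z y \<omega> \<partial>M) = 0"
      and product_integrable: "integrable M (\<lambda>\<omega>. Z y \<omega> * (TZ x \<omega> - Z x \<omega>))" if "y \<in> D" for y
      using residual[OF x that] residual_integrable[OF x that] invariant x that
      by (simp_all add: mult.commute)
    have "AE \<omega> in M. Z x \<omega> = (\<Sum>i=1..q. \<alpha> i * Z (v i x) \<omega>)"
      using x by (intro AE_eq_combination_if_orthogonal orthogonal[unfolded TZ_def]
          product_integrable[unfolded TZ_def] vD)
    then show "\<P>(\<omega> in M. Z x \<omega> = TZ x \<omega>) = 1"
      using modification[OF x] by (simp add: TZ_def)
  qed
qed

end
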